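(* Let $G$ be a global amoeba and let $H$ be a rooted graph. Let $H^*$ be the graph obtained from $H$ by adding an isolated vertex, rooted at the root of $H$. If $H^*$ is hang-symmetric at its root, then the comb product $G*H$ is a global amoeba.
   Context: All graphs are finite and simple. A labeled graph $G$ comes with a bijection $\lambda:V(G)\to X$ onto a label set $X$; write $v_x=\lambda^{-1}(x)$ and $L_G=\{ij: v_iv_j\in E(G)\}$ (unordered pairs). For $\sigma\in\operatorname{Sym}(X)$, $G_\sigma$ is the graph on $V(G)$ with edge set $\{v_iv_j:\sigma(i)\sigma(j)\in L_G\}$. $\operatorname{Aut}(G)$ is identified with $\{\sigma\in\operatorname{Sym}(X): G_\sigma=G\}$. An edge-replacement $rs\to kl$ removes an edge $v_rv_s\in E(G)$ and adds $v_kv_l\in E(\overline G)\cup\{v_rv_s\}$; it is feasible if $G-v_rv_s+v_kv_l\cong G$. $R_G$ is the set of feasible edge-replacements $rs\to kl$ with $rs\ne kl$ together with the neutral replacement $\emptyset\to\emptyset$ (nothing changes). $\operatorname{Fer}_G(rs\to kl)=\{\sigma\in\operatorname{Sym}(X): G_\sigma=G-v_rv_s+v_kv_l\}$ and $\operatorname{Fer}_G(\emptyset\to\emptyset)=\operatorname{Aut}(G)$. $\mathcal{E}_G$ is the union of the sets $\operatorname{Fer}_G(e\to e')$ over all $e\to e'\in R_G$, and $\operatorname{Fer}(G)=\langle\mathcal{E}_G\rangle\le\operatorname{Sym}(X)$. $G$ is a local amoeba if $\operatorname{Fer}(G)=\operatorname{Sym}(X)$, and a global amoeba if $G\cup tK_1$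 is a local amoeba for some integer $t\ge1$ (by a known result, equivalently if $G\cup K_1$ is a local amoeba). For $i\in X$, $\mathcal{E}_G^i=\{\sigma\in\mathcal{E}_G:\sigma(i)=i\}$; the hang group of $G$ at $i$ is $\mathbf{H}_i(G)=\langle\mathcal{E}_G^i\cup\operatorname{Aut}(G)\rangle$, and $G$ is hang-symmetric at $v_i$ if $\mathbf{H}_i(G)=\operatorname{Sym}(X)$. Comb product: for a graph $G$ and a graph $H$ with root $v$, $G*H$ has vertex set $V(G)\times V(H)$, with an edge between $(u,v)$ and $(u',v)$ for each $uu'\in E(G)$, and an edge between $(u,w)$ and $(u,w')$ for each $u\in V(G)$ and $ww'\in E(H)$. *)

theory Defs
  imports "HOL-Combinatorics.Permutations" "HOL-Algebra.Generated_Groups"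
begin

section \<open>Finite simple graphs\<close>

record 'a graph =
  verts :: "'a set"
  edges :: "'a set set"

definition all_pairs :: "'a set \<Rightarrow> 'a set set" where
  "all_pairs V = {{x, y} | x y. x \<in> V \<and> y \<in> V \<and> x \<noteq> y}"

definition simple_graph :: "'a graph \<Rightarrow> bool" where
  "simple_graph G \<longleftrightarrow> finite (verts G) \<and> edges G \<subseteq> all_pairs (verts G)"

definition complement :: "'a graph \<Rightarrow> 'a graph" where
  "complement G = \<lparr>verts = verts G, edges = all_pairs (verts G) - edges G\<rparr>"

definition graph_isomorphic :: "'a graph \<Rightarrow> 'b graph \<Rightarrow> bool" where
  "graph_isomorphic G H \<longleftrightarrow>
     (\<exists>f. bij_betw f (verts G) (verts H) \<and> (`) f ` edges G = edges H)"

text \<open>Disjoint union with \<^term>\<open>t\<close> isolated vertices.\<close>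

definition add_isolated :: "'a graph \<Rightarrow> nat \<Rightarrow> ('a + nat) graph" where
  "add_isolated G t =
     \<lparr>verts = Inl ` verts G \<union> Inr ` {..<t}, edges = (`) Inl ` edges G\<rparr>"

definition comb_product :: "'a graph \<Rightarrow> 'b graph \<Rightarrow> 'b \<Rightarrow> ('a \<times> 'b) graph" where
  "comb_product G H v =
     \<lparr>verts = verts G \<times> verts H,
      edges = {{(u, v), (u', v)} | u u'. {u, u'} \<in> edges G}
            \<union> {{(u, w), (u, w')} | u w w'. u \<in> verts G \<and> {w, w'} \<in> edges H}\<rparr>"


section \<open>Labelled graphs and edge replacements\<close>

text \<open>
  A labelling of \<^term>\<open>G\<close> is a function \<^term>\<open>lam\<close> that is injective on \<^term>\<open>verts G\<close>;
  its label set is the image of \<^term>\<open>verts G\<close>. Graphs are compared with \<open>=\<close> as records,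
  so \<open>permuted_graph\<close> and \<open>replace_edge\<close> keep the vertex set.
\<close>

definition labels :: "('a \<Rightarrow> 'l) \<Rightarrow> 'a graph \<Rightarrow> 'l set" where
  "labels lam G = lam ` verts G"

definition vertex_of :: "('a \<Rightarrow> 'l) \<Rightarrow> 'a graph \<Rightarrow> 'l \<Rightarrow> 'a" where
  "vertex_of lam G = inv_into (verts G) lam"

definition label_edges :: "('a \<Rightarrow> 'l) \<Rightarrow> 'a graph \<Rightarrow> 'l set set" where
  "label_edges lam G =
     {{i, j} | i j. i \<in> labels lam G \<and> j \<in> labels lam G \<and>
                    {vertex_of lam G i, vertex_of lam G j} \<in> edges G}"

definition Sym :: "'l set \<Rightarrow> ('l \<Rightarrow> 'l) monoid" where
  "Sym X = \<lparr>carrier = {p. p permutes X}, mult = (\<circ>), one = id\<rparr>"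

text \<open>The graph written with \<^term>\<open>\<sigma>\<close> as a subscript of \<^term>\<open>G\<close>.\<close>

definition permuted_graph :: "('a \<Rightarrow> 'l) \<Rightarrow> 'a graph \<Rightarrow> ('l \<Rightarrow> 'l) \<Rightarrow> 'a graph" where
  "permuted_graph lam G \<sigma> =
     \<lparr>verts = verts G,
      edges = {{vertex_of lam G i, vertex_of lam G j} | i j.
                 i \<in> labels lam G \<and> j \<in> labels lam G \<and> {\<sigma> i, \<sigma> j} \<in> label_edges lam G}\<rparr>"

definition Aut :: "('a \<Rightarrow> 'l) \<Rightarrow> 'a graph \<Rightarrow> ('l \<Rightarrow> 'l) set" where
  "Aut lam G = {\<sigma> \<in> carrier (Sym (labels lam G)). permuted_graph lam G \<sigma> = G}"

text \<open>
  A replacement is given by two unordered pairs of labels; \<open>Neutral\<close> is the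
  replacement of nothing by nothing.
\<close>

datatype 'l replacement = Neutral | Replace "'l set" "'l set"

definition replace_edge :: "('a \<Rightarrow> 'l) \<Rightarrow> 'a graph \<Rightarrow> 'l set \<Rightarrow> 'l set \<Rightarrow> 'a graph" where
  "replace_edge lam G e e' =
     \<lparr>verts = verts G,
      edges = (edges G - {vertex_of lam G ` e}) \<union> {vertex_of lam G ` e'}\<rparr>"

definition feasible :: "('a \<Rightarrow> 'l) \<Rightarrow> 'a graph \<Rightarrow> 'l set \<Rightarrow> 'l set \<Rightarrow> bool" where
  "feasible lam G e e' \<longleftrightarrow>
     e \<subseteq> labels lam G \<and> e' \<subseteq> labels lam G \<and>
     vertex_of lam G ` e \<in> edges G \<and>
     vertex_of lam G ` e' \<in> edges (complement G) \<union> {vertex_of lam G ` e} \<and>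
     graph_isomorphic (replace_edge lam G e e') G"

definition replacements :: "('a \<Rightarrow> 'l) \<Rightarrow> 'a graph \<Rightarrow> 'l replacement set" where
  "replacements lam G =
     insert Neutral {Replace e e' | e e'. feasible lam G e e' \<and> e \<noteq> e'}"

fun Fer_of :: "('a \<Rightarrow> 'l) \<Rightarrow> 'a graph \<Rightarrow> 'l replacement \<Rightarrow> ('l \<Rightarrow> 'l) set" where
  "Fer_of lam G Neutral = Aut lam G"
| "Fer_of lam G (Replace e e') =
     {\<sigma> \<in> carrier (Sym (labels lam G)). permuted_graph lam G \<sigma> = replace_edge lam G e e'}"

definition Fer_generators :: "('a \<Rightarrow> 'l) \<Rightarrow> 'a graph \<Rightarrow> ('l \<Rightarrow> 'l) set" where
  "Fer_generators lam G = (\<Union>r \<in> replacements lam G. Fer_of lam G r)"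

definition Fer :: "('a \<Rightarrow> 'l) \<Rightarrow> 'a graph \<Rightarrow> ('l \<Rightarrow> 'l) set" where
  "Fer lam G = generate (Sym (labels lam G)) (Fer_generators lam G)"

definition hang_group :: "('a \<Rightarrow> 'l) \<Rightarrow> 'a graph \<Rightarrow> 'l \<Rightarrow> ('l \<Rightarrow> 'l) set" where
  "hang_group lam G i =
     generate (Sym (labels lam G)) ({\<sigma> \<in> Fer_generators lam G. \<sigma> i = i} \<union> Aut lam G)"


section \<open>Amoebas\<close>

text \<open>
  The notions below do not depend on the labelling, so every vertex is taken as its own
  label; \<open>local_amoeba_labelling\<close> and \<open>hang_symmetric_labelling\<close> establish the independence.
\<close>

definition local_amoeba :: "'a graph \<Rightarrow> bool" where
  "local_amoeba G \<longleftrightarrow> Fer id G = carrier (Sym (labels id G))"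

definition global_amoeba :: "'a graph \<Rightarrow> bool" where
  "global_amoeba G \<longleftrightarrow> (\<exists>t\<ge>1. local_amoeba (add_isolated G t))"

definition hang_symmetric :: "'a graph \<Rightarrow> 'a \<Rightarrow> bool" where
  "hang_symmetric G v \<longleftrightarrow> hang_group id G v = carrier (Sym (labels id G))"


section \<open>Independence of the labelling\<close>

lemma group_Sym: "group (Sym X)"
proof (rule groupI)
  fix p assume "p \<in> carrier (Sym X)"
  then have "p permutes X" by (simp add: Sym_def)
  then show "\<exists>q\<in>carrier (Sym X). q \<otimes>\<^bsub>Sym X\<^esub> p = \<one>\<^bsub>Sym X\<^esub>"
    using permutes_inv permutes_inv_o(2) by (fastforce simp: Sym_def)
qed (auto simp: Sym_def permutes_compose permutes_id o_assoc)

context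
  fixes lam :: "'a \<Rightarrow> 'l" and G :: "'a graph"
  assumes inj: "inj_on lam (verts G)"
begin

private abbreviation (input) "V \<equiv> verts G"
private abbreviation (input) "X \<equiv> labels lam G"
private abbreviation (input) "L \<equiv> vertex_of lam G"

private definition conj_perm :: "('a \<Rightarrow> 'a) \<Rightarrow> 'l \<Rightarrow> 'l" where
  "conj_perm \<sigma> = (\<lambda>x. if x \<in> X then lam (\<sigma> (L x)) else x)"

private lemma L_lam: "a \<in> V \<Longrightarrow> L (lam a) = a"
  using inj by (simp add: vertex_of_def)

private lemma lam_L: "x \<in> X \<Longrightarrow> lam (L x) = x"
  by (simp add: vertex_of_def labels_def f_inv_into_f)

private lemma lam_in: "a \<in> V \<Longrightarrow> lam a \<in> X"
  by (simp add: labels_def)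

private lemma L_in: "x \<in> X \<Longrightarrow> L x \<in> V"
  by (simp add: vertex_of_def labels_def inv_into_into)

private lemma vertex_of_id: "a \<in> V \<Longrightarrow> vertex_of id G a = a"
  by (metis vertex_of_def f_inv_into_f id_apply image_id)

private lemma image_vertex_of_id: "e \<subseteq> V \<Longrightarrow> vertex_of id G ` e = e"
  using vertex_of_id by force

private lemma labels_id: "labels id G = V"
  by (simp add: labels_def)

private lemma lam_L_image: "e \<subseteq> X \<Longrightarrow> lam ` L ` e = e"
  using lam_L by force

private lemma L_lam_image: "e \<subseteq> V \<Longrightarrow> L ` lam ` e = e"
  using L_lam by force

private lemma conj_perm_lam: "a \<in> V \<Longrightarrow> conj_perm \<sigma> (lam a) = lam (\<sigma> a)"
  by (simp add: conj_perm_def lam_in L_lam)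

private lemma conj_perm_permutes:
  assumes "\<sigma> permutes V"
  shows "conj_perm \<sigma> permutes X"
proof (rule bij_imp_permutes)
  have "bij_betw lam V X"
    using inj by (simp add: bij_betw_def labels_def)
  moreover have "bij_betw L X V"
    using bij_betw_inv_into[OF \<open>bij_betw lam V X\<close>] by (simp add: vertex_of_def)
  ultimately have "bij_betw (lam \<circ> (\<sigma> \<circ> L)) X X"
    by (intro bij_betw_trans[OF _ \<open>bij_betw lam V X\<close>]
        bij_betw_trans[OF _ permutes_imp_bij[OF assms]])
  moreover have "bij_betw (conj_perm \<sigma>) X X \<longleftrightarrow> bij_betw (lam \<circ> (\<sigma> \<circ> L)) X X"
    by (intro bij_betw_cong) (simp add: conj_perm_def)
  ultimately show "bij_betw (conj_perm \<sigma>) X X" by blast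
qed (simp add: conj_perm_def)

private lemma conj_perm_surj:
  assumes "\<tau> permutes X"
  obtains \<sigma> where "\<sigma> permutes V" "conj_perm \<sigma> = \<tau>"
proof
  let ?\<sigma> = "\<lambda>a. if a \<in> V then L (\<tau> (lam a)) else a"
  have bl: "bij_betw lam V X"
    using inj by (simp add: bij_betw_def labels_def)
  moreover have "bij_betw L X V"
    using bij_betw_inv_into[OF bl] by (simp add: vertex_of_def)
  ultimately have "bij_betw (L \<circ> (\<tau> \<circ> lam)) V V"
    by (intro bij_betw_trans[OF _ \<open>bij_betw L X V\<close>]
        bij_betw_trans[OF _ permutes_imp_bij[OF assms]])
  moreover have "bij_betw ?\<sigma> V V \<longleftrightarrow> bij_betw (L \<circ> (\<tau> \<circ> lam)) V V"
    by (intro bij_betw_cong) simp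
  ultimately have "bij_betw ?\<sigma> V V" by blast
  then show "?\<sigma> permutes V"
    by (rule bij_imp_permutes) simp
  have "conj_perm ?\<sigma> x = \<tau> x" for x
  proof (cases "x \<in> X")
    case True
    then have "\<tau> x \<in> X" using assms by (simp add: permutes_in_image)
    with True show ?thesis by (simp add: conj_perm_def L_in lam_L)
  next
    case False
    then show ?thesis using assms by (simp add: conj_perm_def permutes_not_in)
  qed
  then show "conj_perm ?\<sigma> = \<tau>" by blast
qed

private lemma group_hom_conj: "group_hom (Sym V) (Sym X) conj_perm"
proof (intro group_hom.intro group_Sym group_hom_axioms.intro homI)
  fix p q assume pq: "p \<in> carrier (Sym V)" "q \<in> carrier (Sym V)"
  then have "q permutes V" by (simp add: Sym_def)
  then show "conj_perm (p \<otimes>\<^bsub>Sym V\<^esub> q) = conj_perm p \<otimes>\<^bsub>Sym X\<^esub> conj_perm q"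
    by (auto simp: fun_eq_iff Sym_def conj_perm_def L_in lam_in L_lam permutes_in_image)
qed (simp add: Sym_def conj_perm_permutes)

private lemma conj_carrier: "conj_perm ` carrier (Sym V) = carrier (Sym X)"
proof (intro equalityI subsetI)
  fix \<tau> assume "\<tau> \<in> carrier (Sym X)"
  then have "\<tau> permutes X" by (simp add: Sym_def)
  then obtain \<sigma> where "\<sigma> permutes V" "conj_perm \<sigma> = \<tau>" by (rule conj_perm_surj)
  then show "\<tau> \<in> conj_perm ` carrier (Sym V)" by (auto simp: Sym_def)
qed (auto simp: Sym_def conj_perm_permutes)

private lemma conj_inj: "inj_on conj_perm (carrier (Sym V))"
proof (rule inj_onI)
  fix p q assume pq: "p \<in> carrier (Sym V)" "q \<in> carrier (Sym V)"
    and eq: "conj_perm p = conj_perm q"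
  have perm: "p permutes V" "q permutes V" using pq by (auto simp: Sym_def)
  show "p = q"
  proof
    fix a show "p a = q a"
    proof (cases "a \<in> V")
      case True
      then have "lam (p a) = lam (q a)" using eq conj_perm_lam by metis
      then show ?thesis
        using True perm inj by (metis inj_onD permutes_in_image)
    next
      case False
      then show ?thesis using perm by (simp add: permutes_not_in)
    qed
  qed
qed

private lemma label_edges_iff:
  assumes "a \<in> V" "b \<in> V"
  shows "{lam a, lam b} \<in> label_edges lam G \<longleftrightarrow> {a, b} \<in> edges G"
proof
  assume "{lam a, lam b} \<in> label_edges lam G"
  then obtain i j where ij: "{lam a, lam b} = {i, j}" "{L i, L j} \<in> edges G"
    unfolding label_edges_def by blast
  from ij(1) have "L ` {lam a, lam b} = L ` {i, j}" by (rule arg_cong)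
  then have "{L i, L j} = {a, b}" using assms by (simp add: L_lam)
  then show "{a, b} \<in> edges G" using ij by simp
next
  assume "{a, b} \<in> edges G"
  then have "{L (lam a), L (lam b)} \<in> edges G" using assms by (simp add: L_lam)
  then show "{lam a, lam b} \<in> label_edges lam G"
    unfolding label_edges_def using assms lam_in by blast
qed

private lemma label_edges_id_iff:
  assumes "a \<in> V" "b \<in> V"
  shows "{a, b} \<in> label_edges id G \<longleftrightarrow> {a, b} \<in> edges G"
proof
  assume "{a, b} \<in> label_edges id G"
  then obtain i j where ij: "{a, b} = {i, j}" "i \<in> V" "j \<in> V"
      "{vertex_of id G i, vertex_of id G j} \<in> edges G"
    unfolding label_edges_def labels_id by blast
  then show "{a, b} \<in> edges G" by (simp add: vertex_of_id)
next
  assume "{a, b} \<in> edges G"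
  then have "{vertex_of id G a, vertex_of id G b} \<in> edges G"
    using assms by (simp add: vertex_of_id)
  then show "{a, b} \<in> label_edges id G"
    unfolding label_edges_def labels_id using assms by blast
qed

private lemma permuted_graph_conj:
  assumes "\<sigma> permutes V"
  shows "permuted_graph lam G (conj_perm \<sigma>) = permuted_graph id G \<sigma>"
proof -
  have s: "\<sigma> a \<in> V" if "a \<in> V" for a
    using that assms by (simp add: permutes_in_image)
  have "edges (permuted_graph lam G (conj_perm \<sigma>)) = {{a, b} | a b. a \<in> V \<and> b \<in> V \<and> {\<sigma> a, \<sigma> b} \<in> edges G}"
    (is "?l = ?m")
  proof (intro equalityI subsetI)
    fix e assume "e \<in> ?l"
    then obtain i j where e: "e = {L i, L j}" "i \<in> X" "j \<in> X"
      "{conj_perm \<sigma> i, conj_perm \<sigma> j} \<in> label_edges lam G"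
      by (auto simp: permuted_graph_def)
    then have "{lam (\<sigma> (L i)), lam (\<sigma> (L j))} \<in> label_edges lam G"
      by (simp add: conj_perm_def)
    then show "e \<in> ?m"
      using e label_edges_iff s L_in by blast
  next
    fix e assume "e \<in> ?m"
    then obtain a b where e: "e = {a, b}" "a \<in> V" "b \<in> V" "{\<sigma> a, \<sigma> b} \<in> edges G"
      by blast
    then have "{conj_perm \<sigma> (lam a), conj_perm \<sigma> (lam b)} \<in> label_edges lam G"
      using label_edges_iff s by (simp add: conj_perm_lam)
    moreover have "e = {L (lam a), L (lam b)}" using e L_lam by simp
    ultimately show "e \<in> ?l"
      using e lam_in unfolding permuted_graph_def by auto
  qed
  moreover have "edges (permuted_graph id G \<sigma>) = ?m"
  proof (intro equalityI subsetI)
    fix e assume "e \<in> edges (permuted_graph id G \<sigma>)"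
    then obtain a b where "e = {a, b}" "a \<in> V" "b \<in> V" "{\<sigma> a, \<sigma> b} \<in> label_edges id G"
      by (auto simp: permuted_graph_def labels_id vertex_of_id)
    then show "e \<in> ?m" using label_edges_id_iff s by blast
  next
    fix e assume "e \<in> ?m"
    then obtain a b where e: "e = {a, b}" "a \<in> V" "b \<in> V" "{\<sigma> a, \<sigma> b} \<in> edges G"
      by blast
    then have "{\<sigma> a, \<sigma> b} \<in> label_edges id G" "e = {vertex_of id G a, vertex_of id G b}"
      using label_edges_id_iff s vertex_of_id by auto
    then show "e \<in> edges (permuted_graph id G \<sigma>)"
      using e labels_id unfolding permuted_graph_def by auto
  qed
  ultimately show ?thesis
    by (simp add: permuted_graph_def)
qed

private lemma conj_image:
  assumes "\<And>\<sigma>. \<sigma> permutes V \<Longrightarrow> P (conj_perm \<sigma>) \<longleftrightarrow> Q \<sigma>"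
  shows "{\<tau> \<in> carrier (Sym X). P \<tau>} = conj_perm ` {\<sigma> \<in> carrier (Sym V). Q \<sigma>}"
proof (intro equalityI subsetI)
  fix \<tau> assume \<tau>: "\<tau> \<in> {\<tau> \<in> carrier (Sym X). P \<tau>}"
  then have "\<tau> permutes X" by (simp add: Sym_def)
  then obtain \<sigma> where "\<sigma> permutes V" "conj_perm \<sigma> = \<tau>" by (rule conj_perm_surj)
  with \<tau> assms show "\<tau> \<in> conj_perm ` {\<sigma> \<in> carrier (Sym V). Q \<sigma>}"
    by (auto simp: Sym_def)
qed (use assms in \<open>auto simp: Sym_def conj_perm_permutes\<close>)

private lemma Aut_conj: "Aut lam G = conj_perm ` Aut id G"
  unfolding Aut_def labels_id by (rule conj_image) (simp add: permuted_graph_conj)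

private lemma replace_edge_lam:
  assumes "e \<subseteq> V" "e' \<subseteq> V"
  shows "replace_edge lam G (lam ` e) (lam ` e') = replace_edge id G e e'"
  using assms by (simp add: replace_edge_def L_lam_image image_vertex_of_id)

private lemma feasible_lam:
  assumes "e \<subseteq> V" "e' \<subseteq> V"
  shows "feasible lam G (lam ` e) (lam ` e') \<longleftrightarrow> feasible id G e e'"
  using assms
  by (auto simp: feasible_def replace_edge_lam L_lam_image image_vertex_of_id labels_id labels_def)

private lemma Fer_of_conj:
  assumes "e \<subseteq> V" "e' \<subseteq> V"
  shows "Fer_of lam G (Replace (lam ` e) (lam ` e')) = conj_perm ` Fer_of id G (Replace e e')"
  unfolding Fer_of.simps labels_id replace_edge_lam[OF assms]
  by (rule conj_image) (simp add: permuted_graph_conj)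

private lemma replacements_lam:
  "replacements lam G =
     insert Neutral {Replace (lam ` e) (lam ` e') | e e'. feasible id G e e' \<and> e \<noteq> e'}"
proof -
  have "(\<exists>e e'. r = Replace e e' \<and> feasible lam G e e' \<and> e \<noteq> e') \<longleftrightarrow>
        (\<exists>e e'. r = Replace (lam ` e) (lam ` e') \<and> feasible id G e e' \<and> e \<noteq> e')" for r
  proof
    assume "\<exists>e e'. r = Replace e e' \<and> feasible lam G e e' \<and> e \<noteq> e'"
    then obtain e e' where r: "r = Replace e e'" "feasible lam G e e'" "e \<noteq> e'" by blast
    then have sub: "e \<subseteq> X" "e' \<subseteq> X" by (auto simp: feasible_def)
    have eq: "lam ` L ` e = e" "lam ` L ` e' = e'"
      by (fact lam_L_image[OF sub(1)], fact lam_L_image[OF sub(2)])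
    have "L ` e \<subseteq> V" "L ` e' \<subseteq> V"
      using sub L_in by blast+
    from feasible_lam[OF this] have "feasible id G (L ` e) (L ` e')"
      using r(2) by (simp only: eq)
    moreover have "L ` e \<noteq> L ` e'" using eq r(3) by metis
    moreover have "r = Replace (lam ` L ` e) (lam ` L ` e')" by (simp only: eq r(1))
    ultimately show "\<exists>e e'. r = Replace (lam ` e) (lam ` e') \<and> feasible id G e e' \<and> e \<noteq> e'"
      by blast
  next
    assume "\<exists>e e'. r = Replace (lam ` e) (lam ` e') \<and> feasible id G e e' \<and> e \<noteq> e'"
    then obtain e e' where r: "r = Replace (lam ` e) (lam ` e')" "feasible id G e e'" "e \<noteq> e'"
      by blast
    then have sub: "e \<subseteq> V" "e' \<subseteq> V" by (auto simp: feasible_def labels_id)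
    then have "feasible lam G (lam ` e) (lam ` e')" using feasible_lam[OF sub] r(2) by simp
    moreover have "lam ` e \<noteq> lam ` e'"
      using r(3) inj_on_image_eq_iff[OF inj sub] by simp
    ultimately show "\<exists>e e'. r = Replace e e' \<and> feasible lam G e e' \<and> e \<noteq> e'"
      using r(1) by blast
  qed
  then show ?thesis unfolding replacements_def by (intro arg_cong[of _ _ "insert Neutral"] Collect_cong)
qed

private lemma Fer_generators_conj: "Fer_generators lam G = conj_perm ` Fer_generators id G"
proof -
  have "Fer_of lam G (Replace (lam ` e) (lam ` e')) = conj_perm ` Fer_of id G (Replace e e')"
    if "feasible id G e e'" for e e'
    using that by (intro Fer_of_conj) (auto simp: feasible_def labels_id)
  then have "(\<Union>r \<in> {Replace (lam ` e) (lam ` e') | e e'. feasible id G e e' \<and> e \<noteq> e'}. Fer_of lam G r)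
      = conj_perm ` (\<Union>r \<in> {Replace e e' | e e'. feasible id G e e' \<and> e \<noteq> e'}. Fer_of id G r)"
    unfolding image_UN by (fastforce simp del: Fer_of.simps)
  then show ?thesis
    unfolding Fer_generators_def replacements_lam unfolding replacements_def
    by (simp only: UN_insert image_Un Fer_of.simps(1) Aut_conj)
qed

private lemma Fer_generators_carrier: "Fer_generators id G \<subseteq> carrier (Sym V)"
  by (auto simp: Fer_generators_def replacements_def Aut_def labels_id)

private lemma Aut_carrier: "Aut id G \<subseteq> carrier (Sym V)"
  by (auto simp: Aut_def labels_id)

private lemma generate_conj:
  assumes "K \<subseteq> carrier (Sym V)"
  shows "generate (Sym X) (conj_perm ` K) = carrier (Sym X) \<longleftrightarrow> generate (Sym V) K = carrier (Sym V)"
proof -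
  have "generate (Sym X) (conj_perm ` K) = conj_perm ` generate (Sym V) K"
    using group_hom.generate_img[OF group_hom_conj assms] by simp
  moreover have "generate (Sym V) K \<subseteq> carrier (Sym V)"
    using group.generate_incl[OF group_Sym assms] .
  ultimately show ?thesis
    using inj_on_image_eq_iff[OF conj_inj] conj_carrier by (metis order_refl)
qed

lemma local_amoeba_labelling:
  "Fer lam G = carrier (Sym (labels lam G)) \<longleftrightarrow> local_amoeba G"
  unfolding local_amoeba_def Fer_def Fer_generators_conj labels_id
  by (rule generate_conj[OF Fer_generators_carrier])

lemma hang_symmetric_labelling:
  assumes "v \<in> verts G"
  shows "hang_group lam G (lam v) = carrier (Sym (labels lam G)) \<longleftrightarrow> hang_symmetric G v"
proof -
  have "conj_perm \<sigma> (lam v) = lam v \<longleftrightarrow> \<sigma> v = v" if "\<sigma> \<in> Fer_generators id G" for \<sigma>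
  proof -
    have "\<sigma> v \<in> V"
      using that Fer_generators_carrier assms by (auto simp: Sym_def permutes_in_image)
    then show ?thesis
      using assms inj by (auto simp: conj_perm_lam dest: inj_onD)
  qed
  then have "{\<sigma> \<in> Fer_generators lam G. \<sigma> (lam v) = lam v} =
      conj_perm ` {\<sigma> \<in> Fer_generators id G. \<sigma> v = v}"
    unfolding Fer_generators_conj by blast
  then show ?thesis
    unfolding hang_symmetric_def hang_group_def Aut_conj labels_id
    using generate_conj[of "{\<sigma> \<in> Fer_generators id G. \<sigma> v = v} \<union> Aut id G"]
      Fer_generators_carrier Aut_carrier by (auto simp: image_Un)
qed

end

end

theory Submission
  imports Defs
begin

text \<open>
  A permutation generates \<open>Fer\<close> iff the preimage of the edge set has at most one new edge. Add one
  isolated vertex \<open>z\<close> to \<open>G * H\<close>; it suffices to obtain the transpositions of \<open>z\<close> with every vertex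
  of every copy of \<open>H\<close>. If \<open>u\<close> has degree at most one in \<open>G\<close>, then hang-symmetry gives them on the copy
  at \<open>u\<close>: root-fixing generators extend by the identity, and an automorphism that moves the root
  merely moves the at most one edge of \<open>G\<close> at \<open>u\<close>. From there they spread by conjugation along the
  generators of \<open>G \<union> tK\<^sub>1\<close>. Such a generator either sends an isolated vertex to a vertex of
  degree at most one, or its action on a pair of vertices of \<open>G\<close> is realised by a generator that
  preserves \<open>G\<close>, which then lifts to \<open>G * H\<close>.
\<close>

section \<open>Permutations that move at most one edge\<close>

text \<open>The sets that \<open>\<sigma>\<close> maps onto members of \<open>E\<close> form the
  edge set of the permuted graph. Bounding only the new edges is enough: a finite \<open>E\<close>
  and its preimage have equal size, so at most one edge is lost as well. The neutral replacement is
  the case in which \<open>e'\<close> contributes nothing.\<close>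

definition moves_one_edge :: "'c set set \<Rightarrow> ('c \<Rightarrow> 'c) \<Rightarrow> bool" where
  "moves_one_edge E \<sigma> \<longleftrightarrow> (\<exists>e'. \<forall>e. \<sigma> ` e \<in> E \<longrightarrow> e \<in> insert e' E)"

lemma labels_id: "labels id G = verts G"
  by (simp add: labels_def)

lemma vertex_of_id: "a \<in> verts G \<Longrightarrow> vertex_of id G a = a"
  by (metis vertex_of_def f_inv_into_f id_apply image_id)

lemma image_vertex_of_id: "e \<subseteq> verts G \<Longrightarrow> vertex_of id G ` e = e"
  using vertex_of_id by force

lemma simple_graph_edgeE:
  assumes "simple_graph G" "e \<in> edges G"
  obtains x y where "e = {x, y}" "x \<in> verts G" "y \<in> verts G" "x \<noteq> y"
  using assms unfolding simple_graph_def all_pairs_def by blast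

lemma simple_graph_edge_subset: "simple_graph G \<Longrightarrow> e \<in> edges G \<Longrightarrow> e \<subseteq> verts G"
  by (elim simple_graph_edgeE) auto

lemma finite_edges: "simple_graph G \<Longrightarrow> finite (edges G)"
  using simple_graph_edge_subset[of G] finite_subset[of "edges G" "Pow (verts G)"]
  by (auto simp: simple_graph_def)

text \<open>With every vertex as its own label, \<open>label_edges\<close> is the edge set itself. A
  set that a permutation maps onto an edge is already a pair of vertices, so the right-hand side can
  range over arbitrary sets.\<close>

lemma edges_permuted_graph:
  assumes "simple_graph G" "\<sigma> permutes verts G"
  shows "edges (permuted_graph id G \<sigma>) = {e. \<sigma> ` e \<in> edges G}"
proof -
  have L: "label_edges id G = edges G"
  proof (intro equalityI subsetI)
    fix e assume "e \<in> label_edges id G"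
    then show "e \<in> edges G"
      by (auto simp: label_edges_def labels_id vertex_of_id)
  next
    fix e assume e: "e \<in> edges G"
    from simple_graph_edgeE[OF assms(1) e] obtain x y
      where "e = {x, y}" "x \<in> verts G" "y \<in> verts G" .
    with e show "e \<in> label_edges id G"
      unfolding label_edges_def labels_id
      by (intro CollectI exI[of _ x] exI[of _ y]) (simp add: vertex_of_id)
  qed
  show ?thesis
  proof (intro equalityI subsetI)
    fix e assume "e \<in> edges (permuted_graph id G \<sigma>)"
    then show "e \<in> {e. \<sigma> ` e \<in> edges G}"
      by (auto simp: permuted_graph_def L labels_id vertex_of_id)
  next
    fix e assume "e \<in> {e. \<sigma> ` e \<in> edges G}"
    then have e: "\<sigma> ` e \<in> edges G" by simp
    from simple_graph_edgeE[OF assms(1) e] obtain x y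
      where xy: "\<sigma> ` e = {x, y}" "x \<in> verts G" "y \<in> verts G" .
    have "e = inv_into UNIV \<sigma> ` \<sigma> ` e"
      by (simp add: permutes_inj[OF assms(2)] image_inv_f_f)
    then have *: "e = {inv_into UNIV \<sigma> x, inv_into UNIV \<sigma> y}" using xy by simp
    have "inv_into UNIV \<sigma> x \<in> verts G" "inv_into UNIV \<sigma> y \<in> verts G"
      using xy permutes_in_image[OF permutes_inv[OF assms(2)]] by auto
    moreover have "{\<sigma> (inv_into UNIV \<sigma> x), \<sigma> (inv_into UNIV \<sigma> y)} \<in> edges G"
      using e xy permutes_inverses(1)[OF assms(2)] by simp
    ultimately show "e \<in> edges (permuted_graph id G \<sigma>)"
      unfolding permuted_graph_def L labels_id
      using *
      by (simp, intro exI[of _ "inv_into UNIV \<sigma> x"] exI[of _ "inv_into UNIV \<sigma> y"])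
        (simp add: vertex_of_id)
  qed
qed

lemma verts_permuted_graph [simp]: "verts (permuted_graph lam G \<sigma>) = verts G"
  by (simp add: permuted_graph_def)

lemma Aut_iff:
  assumes "simple_graph G"
  shows "\<sigma> \<in> Aut id G \<longleftrightarrow> \<sigma> permutes verts G \<and> (\<forall>e. \<sigma> ` e \<in> edges G \<longleftrightarrow> e \<in> edges G)"
proof -
  have "permuted_graph id G \<sigma> = G \<longleftrightarrow> edges (permuted_graph id G \<sigma>) = edges G"
    by (cases G) (simp add: permuted_graph_def)
  then show ?thesis
    using edges_permuted_graph[OF assms] by (auto simp: Aut_def Sym_def labels_id)
qed

text \<open>Provides both the equal edge counts and the graph isomorphism that feasibility asks
  for.\<close>

lemma bij_betw_preimage_edges:
  assumes "\<sigma> permutes verts G"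
  shows "bij_betw ((`) \<sigma>) {e. \<sigma> ` e \<in> edges G} (edges G)"
proof (rule bij_betw_imageI)
  show "inj_on ((`) \<sigma>) {e. \<sigma> ` e \<in> edges G}"
    using permutes_inj[OF assms] by (simp add: inj_on_def inj_image_eq_iff)
  have "e \<in> (`) \<sigma> ` {e. \<sigma> ` e \<in> edges G}" if "e \<in> edges G" for e
    using that permutes_surj[OF assms]
    by (intro image_eqI[of _ _ "inv_into UNIV \<sigma> ` e"]) (auto simp: image_f_inv_f)
  then show "(`) \<sigma> ` {e. \<sigma> ` e \<in> edges G} = edges G" by auto
qed

text \<open>The preimage of the edge set has the same size as the edge set. Without a new edge the
  two coincide and \<open>\<sigma>\<close> is an automorphism; with one new edge \<open>e'\<close>
  exactly one edge \<open>e\<close> is missing, and \<open>\<sigma>\<close> realises the replacement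
  of \<open>e\<close> by \<open>e'\<close>.\<close>

lemma Fer_generators_iff:
  assumes "simple_graph G"
  shows "\<sigma> \<in> Fer_generators id G \<longleftrightarrow> \<sigma> permutes verts G \<and> moves_one_edge (edges G) \<sigma>"
proof
  assume "\<sigma> \<in> Fer_generators id G"
  then obtain r where "r \<in> replacements id G" "\<sigma> \<in> Fer_of id G r"
    by (auto simp: Fer_generators_def)
  then consider "\<sigma> \<in> Aut id G"
    | e e' where "\<sigma> \<in> Fer_of id G (Replace e e')"
    by (auto simp: replacements_def simp del: Fer_of.simps(2))
  then show "\<sigma> permutes verts G \<and> moves_one_edge (edges G) \<sigma>"
  proof cases
    case 1
    then show ?thesis by (auto simp: Aut_iff[OF assms] moves_one_edge_def)
  next
    case 2
    then have perm: "\<sigma> permutes verts G"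
      and rep: "permuted_graph id G \<sigma> = replace_edge id G e e'"
      by (auto simp: Sym_def labels_id)
    have "{e. \<sigma> ` e \<in> edges G} = edges (replace_edge id G e e')"
      using edges_permuted_graph[OF assms perm] rep by simp
    moreover have "edges (replace_edge id G e e') \<subseteq> insert (vertex_of id G ` e') (edges G)"
      unfolding replace_edge_def by (simp add: subset_iff)
    ultimately have "\<And>f. \<sigma> ` f \<in> edges G \<Longrightarrow> f \<in> insert (vertex_of id G ` e') (edges G)"
      by blast
    then show ?thesis
      using perm unfolding moves_one_edge_def by blast
  qed
next
  assume *: "\<sigma> permutes verts G \<and> moves_one_edge (edges G) \<sigma>"
  let ?E = "edges G" and ?P = "{e. \<sigma> ` e \<in> edges G}"
  note perm = conjunct1[OF *]
  note PE = edges_permuted_graph[OF assms perm]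
  from * obtain e' where e': "?P \<subseteq> insert e' ?E" by (auto simp: moves_one_edge_def)
  have fin: "finite ?E" by (rule finite_edges[OF assms])
  then have finP: "finite ?P" using e' finite_subset by blast
  have card: "card ?P = card ?E"
    by (rule bij_betw_same_card[OF bij_betw_preimage_edges[OF perm]])
  show "\<sigma> \<in> Fer_generators id G"
  proof (cases "?P \<subseteq> ?E")
    case True
    then have "?P = ?E" using card card_subset_eq[OF fin] by blast
    then have "\<sigma> \<in> Aut id G" using perm by (auto simp: Aut_iff[OF assms])
    then show ?thesis by (auto simp: Fer_generators_def replacements_def)
  next
    case False
    then have e'P: "e' \<in> ?P" "e' \<notin> ?E" using e' by auto
    have "card (?P - {e'}) = card ?E - 1"
      using e'P finP card by simp
    moreover have sub: "?P - {e'} \<subseteq> ?E" using e' by auto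
    ultimately have "card (?E - (?P - {e'})) = 1"
      using e'P card fin finP card_gt_0_iff[of ?P] by (subst card_Diff_subset) (auto intro: finite_subset)
    then obtain e where e: "?E - (?P - {e'}) = {e}" by (rule card_1_singletonE)
    have P: "?P = (?E - {e}) \<union> {e'}" using e e'P sub by blast
    have eE: "e \<in> ?E" using e by auto
    \<comment> \<open>A replacement has to add a pair of distinct vertices; the points of
      \<open>e'\<close> are distinct because \<open>\<sigma>\<close> maps \<open>e'\<close> onto an
      edge.\<close>
    have e'V: "e' \<in> all_pairs (verts G)" "e' \<subseteq> verts G"
    proof -
      have "e' \<in> edges (permuted_graph id G \<sigma>)" using PE e'P by simp
      then obtain i j where ij: "e' = {i, j}" "i \<in> verts G" "j \<in> verts G"
        unfolding permuted_graph_def labels_id by (auto simp: vertex_of_id)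
      have "\<sigma> ` e' \<in> ?E" using e'P by simp
      from simple_graph_edgeE[OF assms this] ij have "i \<noteq> j"
        by (metis image_empty image_insert doubleton_eq_iff)
      with ij show "e' \<in> all_pairs (verts G)" "e' \<subseteq> verts G" by (auto simp: all_pairs_def)
    qed
    have eV: "e \<subseteq> verts G" by (rule simple_graph_edge_subset[OF assms eE])
    have rep: "permuted_graph id G \<sigma> = replace_edge id G e e'"
      using PE P by (simp add: replace_edge_def permuted_graph_def image_vertex_of_id eV e'V)
    \<comment> \<open>Feasibility comes for free, with \<open>\<sigma>\<close> itself as the
      isomorphism.\<close>
    have "graph_isomorphic (permuted_graph id G \<sigma>) G"
      unfolding graph_isomorphic_def PE
      using permutes_imp_bij[OF perm] bij_betw_preimage_edges[OF perm]
      by (intro exI[of _ \<sigma>]) (simp add: bij_betw_def)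
    then have "feasible id G e e'"
      unfolding feasible_def rep
      using eV e'V eE e'P by (simp add: labels_id image_vertex_of_id complement_def)
    moreover have "e \<noteq> e'" using eE e'P by auto
    ultimately have "Replace e e' \<in> replacements id G"
      by (auto simp: replacements_def)
    then show ?thesis
      unfolding Fer_generators_def
      by (rule UN_I) (use perm rep in \<open>simp add: Sym_def labels_id\<close>)
  qed
qed

section \<open>Generated permutation groups\<close>

lemma inv_Sym: "p permutes X \<Longrightarrow> inv\<^bsub>Sym X\<^esub> p = inv_into UNIV p"
  by (rule group.inv_equality[OF group_Sym]) (auto simp: Sym_def permutes_inv permutes_inv_o)

lemma generate_comp:
  "p \<in> generate (Sym X) K \<Longrightarrow> q \<in> generate (Sym X) K \<Longrightarrow> p \<circ> q \<in> generate (Sym X) K"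
  using generate.eng[of p "Sym X" K q] by (simp add: Sym_def)

lemma generate_inv:
  assumes "K \<subseteq> carrier (Sym X)" "p \<in> generate (Sym X) K"
  shows "inv_into UNIV p \<in> generate (Sym X) K"
proof -
  have "p permutes X"
    using group.generate_in_carrier[OF group_Sym assms] by (simp add: Sym_def)
  then show ?thesis
    using group.generate_m_inv_closed[OF group_Sym assms] by (simp add: inv_Sym)
qed

text \<open>Setwise stabilizers are subgroups, so invariance of a set need only be checked on
  generators.\<close>

lemma generate_stabilizes:
  assumes K: "\<And>h. h \<in> K \<Longrightarrow> h permutes X \<and> h ` S = S" and "p \<in> generate (Sym X) K"
  shows "p permutes X \<and> p ` S = S"
  using assms(2)
proof (induction rule: generate.induct)
  case one
  then show ?case by (simp add: Sym_def permutes_id[unfolded id_def])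
next
  case (incl h)
  then show ?case by (rule K)
next
  case (inv h)
  then have h: "h permutes X" "h ` S = S" using K by blast+
  then have "inv_into UNIV h ` S = S" by (metis image_inv_f_f permutes_inj)
  then show ?case using h(1) by (simp add: inv_Sym permutes_inv)
next
  case (eng p q)
  then have "(p \<circ> q) permutes X" "(p \<circ> q) ` S = S"
    by (simp_all add: permutes_compose image_comp[symmetric] del: o_apply)
  moreover have "p \<otimes>\<^bsub>Sym X\<^esub> q = p \<circ> q" by (simp add: Sym_def)
  ultimately show ?case by metis
qed

text \<open>Transport along an injection, with the identity elsewhere, is a homomorphism of
  symmetric groups, and homomorphisms respect generated subgroups.\<close>

lemma map_permutation_in_generate:
  assumes "inj_on f A" "f ` A \<subseteq> B" "K \<subseteq> carrier (Sym A)" "L \<subseteq> carrier (Sym B)"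
    and "\<And>\<sigma>. \<sigma> \<in> K \<Longrightarrow> map_permutation A f \<sigma> \<in> L"
    and "\<sigma> \<in> generate (Sym A) K"
  shows "map_permutation A f \<sigma> \<in> generate (Sym B) L"
proof -
  have perm: "map_permutation A f p permutes B" if "p permutes A" for p
    using map_permutation_permutes[OF inj_on_imp_bij_betw[OF assms(1)] that] assms(2)
    by (rule permutes_subset)
  have "group_hom (Sym A) (Sym B) (map_permutation A f)"
    by (intro group_hom.intro group_Sym group_hom_axioms.intro homI)
      (auto simp: Sym_def perm map_permutation_compose'[OF assms(1)])
  from group_hom.generate_img[OF this assms(3)]
  have "map_permutation A f \<sigma> \<in> generate (Sym B) (map_permutation A f ` K)"
    using assms(6) by blast
  then show ?thesis
    using group.mono_generate[OF group_Sym, of "map_permutation A f ` K" L] assms(5) by blast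
qed

text \<open>Conjugating the transposition of \<open>z\<close> and \<open>b\<close> by that of
  \<open>a\<close> and \<open>z\<close> gives the transposition of \<open>a\<close> and
  \<open>b\<close>, and transpositions generate a finite symmetric group.\<close>

lemma generate_eq_Sym_if_star_transpositions:
  assumes "finite X" "K \<subseteq> carrier (Sym X)"
    and star: "\<And>x. x \<in> X \<Longrightarrow> transpose x z \<in> generate (Sym X) K"
  shows "generate (Sym X) K = carrier (Sym X)"
proof (rule equalityI)
  have trans: "transpose a b \<in> generate (Sym X) K" if "a \<in> X" "b \<in> X" "a \<noteq> b" for a b
  proof (cases "b = z")
    case False
    have "transpose a z \<circ> transpose z b \<circ> transpose a z = transpose a b"
      using False that by (intro transpose_comp_triple) auto
    moreover have "transpose a z \<circ> transpose z b \<circ> transpose a z \<in> generate (Sym X) K"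
      using star that by (intro generate_comp) (auto simp: transpose_commute)
    ultimately show ?thesis by simp
  qed (use that star in auto)
  show "carrier (Sym X) \<subseteq> generate (Sym X) K"
  proof
    fix p assume "p \<in> carrier (Sym X)"
    then have "p permutes X" by (simp add: Sym_def)
    then show "p \<in> generate (Sym X) K"
      using assms(1)
    proof (induction rule: permutes_induct)
      case id
      have "id = \<one>\<^bsub>Sym X\<^esub>" by (simp add: Sym_def)
      then show ?case by (metis generate.one)
    next
      case (swap a b p)
      then show ?case by (intro generate_comp trans)
    qed
  qed
qed (rule group.generate_incl[OF group_Sym assms(2)])

lemma Fer_generators_carrier:
  "simple_graph G \<Longrightarrow> Fer_generators id G \<subseteq> carrier (Sym (verts G))"
  by (auto simp: Fer_generators_iff Sym_def)

lemma permutation_in_Fer: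
  assumes "simple_graph G" "\<sigma> permutes verts G" "moves_one_edge (edges G) \<sigma>"
  shows "\<sigma> \<in> Fer id G"
  unfolding Fer_def labels_id using assms by (intro generate.incl) (simp add: Fer_generators_iff)

lemma simple_graph_add_isolated: "simple_graph G \<Longrightarrow> simple_graph (add_isolated G t)"
  unfolding simple_graph_def add_isolated_def all_pairs_def by (auto; blast)

section \<open>Permutations preserving a set of isolated vertices\<close>

text \<open>
  If \<open>h\<close> moves \<open>c \<in> T\<close> out of \<open>T\<close> and \<open>a \<notin> T\<close> into \<open>T\<close>, then precomposing with the
  transposition of \<open>a\<close> and \<open>c\<close> still moves at most one edge: an edge sent into \<open>E\<close> meets neither
  \<open>c\<close>, whose new image is isolated, nor \<open>a\<close> unless it comes from the edge moved by \<open>h\<close>.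
\<close>

lemma moves_one_edge_preserving_isolated:
  assumes "h permutes X" "T \<subseteq> X" "finite T" "\<And>e. e \<in> E \<Longrightarrow> e \<inter> T = {}"
    and "moves_one_edge E h"
  shows "\<exists>h'. h' permutes X \<and> moves_one_edge E h' \<and> h' ` T = T \<and>
    (\<forall>x. x \<notin> T \<longrightarrow> h x \<notin> T \<longrightarrow> h' x = h x)"
  using assms(1,5)
proof (induction "card {x\<in>T. h x \<notin> T}" arbitrary: h rule: less_induct)
  case less
  note inj = permutes_inj[OF less.prems(1)]
  show ?case
  proof (cases "h ` T \<subseteq> T")
    case True
    then have "h ` T = T"
      using assms(3) inj by (intro endo_inj_surj) (auto intro: inj_on_subset)
    then show ?thesis using less.prems by blast
  next
    case False
    then obtain c where c: "c \<in> T" "h c \<notin> T" by blast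
    have "\<exists>a. a \<notin> T \<and> h a \<in> T"
    proof (rule ccontr)
      assume "\<nexists>a. a \<notin> T \<and> h a \<in> T"
      then have "inv_into UNIV h ` T \<subseteq> T"
        using permutes_inverses[OF less.prems(1)] by (metis image_subsetI)
      then have "inv_into UNIV h ` T = T"
        using assms(3) permutes_inj[OF permutes_inv[OF less.prems(1)]]
        by (intro endo_inj_surj) (auto intro: inj_on_subset)
      then have "h ` T = T" by (metis image_f_inv_f permutes_surj less.prems(1))
      with c show False by blast
    qed
    then obtain a where a: "a \<notin> T" "h a \<in> T" by blast
    let ?t = "transpose a c"
    let ?h = "h \<circ> ?t"
    have "a \<in> X" using a less.prems(1) assms(2) by (metis permutes_not_in subsetD)
    then have perm: "?h permutes X"
      using c assms(2) by (intro permutes_compose[OF permutes_swap_id less.prems(1)]) auto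
    \<comment> \<open>The new map sends \<open>c\<close> to \<open>h a\<close>, which lies in
      \<open>T\<close>, and agrees with \<open>h\<close> on the rest of \<open>T\<close>; hence just
      \<open>c\<close> drops out of the set.\<close>
    have "{x\<in>T. ?h x \<notin> T} \<subset> {x\<in>T. h x \<notin> T}"
      using a c by (auto simp: transpose_def)
    then have lt: "card {x\<in>T. ?h x \<notin> T} < card {x\<in>T. h x \<notin> T}"
      using assms(3) by (intro psubset_card_mono) auto
    from less.prems(2) obtain e0 where e0: "\<And>e. h ` e \<in> E \<Longrightarrow> e \<in> insert e0 E"
      by (auto simp: moves_one_edge_def)
    have "e \<in> insert (?t ` e0) E" if e: "?h ` e \<in> E" for e
    proof -
      have tt: "?t ` ?t ` e = e" by (simp add: image_image)
      have "h ` ?t ` e \<in> E" using e by (simp add: image_comp)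
      then have "?t ` e = e0 \<or> ?t ` e \<in> E" using e0 by blast
      then show ?thesis
      proof
        assume "?t ` e \<in> E"
        then have "c \<notin> ?t ` e" using assms(4) c by blast
        then have "a \<notin> e" by (auto simp: in_transpose_image_iff)
        moreover have "c \<notin> e"
        proof
          assume "c \<in> e"
          then have "h a \<in> ?h ` e" by force
          then show False using assms(4)[OF e] a by blast
        qed
        ultimately have "?t ` e = e" by simp
        then show ?thesis using \<open>?t ` e \<in> E\<close> by simp
      qed (use tt in auto)
    qed
    then have "moves_one_edge E ?h" unfolding moves_one_edge_def by blast
    from less.hyps[OF lt perm this] obtain h' where h': "h' permutes X" "moves_one_edge E h'"
      "h' ` T = T" "\<forall>x. x \<notin> T \<longrightarrow> ?h x \<notin> T \<longrightarrow> h' x = ?h x" by blast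
    have "h' x = h x" if "x \<notin> T" "h x \<notin> T" for x
    proof -
      \<comment> \<open>Such an \<open>x\<close> differs from \<open>a\<close>, whose image lies in
        \<open>T\<close>, and from \<open>c\<close>, which lies in \<open>T\<close> itself.\<close>
      have "?t x = x" using that a c by (intro transpose_apply_other) auto
      then show ?thesis using h'(4) that by simp
    qed
    then show ?thesis using h' by blast
  qed
qed

text \<open>Once \<open>h\<close> is corrected so as to preserve the isolated vertices, it restricts
  to \<open>G\<close>. The correction keeps the value at \<open>Inl u\<close>, since neither this
  vertex nor its image is isolated.\<close>

lemma moves_one_edge_restrict_add_isolated:
  assumes "simple_graph G" "h permutes verts (add_isolated G t)"
    and "moves_one_edge (edges (add_isolated G t)) h" "h (Inl u) = Inl w"
  shows "\<exists>\<gamma>. \<gamma> permutes verts G \<and> moves_one_edge (edges G) \<gamma> \<and> \<gamma> u = w"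
proof -
  let ?X = "verts (add_isolated G t)" and ?E = "edges (add_isolated G t)"
    and ?T = "Inr ` {..<t} :: ('a + nat) set"
  have "\<exists>h'. h' permutes ?X \<and> moves_one_edge ?E h' \<and> h' ` ?T = ?T \<and>
    (\<forall>x. x \<notin> ?T \<longrightarrow> h x \<notin> ?T \<longrightarrow> h' x = h x)"
    using assms(2,3)
    by (intro moves_one_edge_preserving_isolated) (auto simp: add_isolated_def)
  then obtain h' where h': "h' permutes ?X" "moves_one_edge ?E h'" "h' ` ?T = ?T"
    and eq: "\<forall>x. x \<notin> ?T \<longrightarrow> h x \<notin> ?T \<longrightarrow> h' x = h x"
    by blast
  from eq[rule_format, of "Inl u"] have h'u: "h' (Inl u) = Inl w"
    using assms(4) by auto
  have inj: "inj h'" by (rule permutes_inj[OF h'(1)])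
  define \<gamma> where "\<gamma> = (\<lambda>a. projl (h' (Inl a)))"
  \<comment> \<open>This also covers \<open>a\<close> outside \<open>verts G\<close>, where
    \<open>h'\<close> is the identity, so \<open>projl\<close> is never applied to an isolated
    vertex.\<close>
  have Inl: "h' (Inl a) = Inl (\<gamma> a)" for a
  proof (cases "h' (Inl a)")
    case (Inr n)
    have "h' (Inl a) \<notin> ?T"
      using h'(3) inj by (metis (no_types) Inl_Inr_False image_iff inj_image_mem_iff)
    moreover have "Inl a \<in> ?X"
      using Inr h'(1) by (metis permutes_not_in sum.distinct(1))
    then have "h' (Inl a) \<in> ?X" using h'(1) by (simp add: permutes_in_image)
    ultimately show ?thesis using Inr by (auto simp: add_isolated_def)
  qed (simp add: \<gamma>_def)
  have "\<gamma> permutes verts G"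
  proof (rule inj_imp_permutes)
    show "inj_on \<gamma> (verts G)" using inj Inl by (metis injD inj_onI sum.inject(1))
    show "\<gamma> x \<in> verts G" if "x \<in> verts G" for x
    proof -
      have "h' (Inl x) \<in> ?X"
        using that h'(1) permutes_in_image[of h' ?X "Inl x"] by (simp add: add_isolated_def)
      then show ?thesis by (auto simp: Inl add_isolated_def)
    qed
    show "\<gamma> x = x" if "x \<notin> verts G" for x
    proof -
      have "Inl x \<notin> ?X" using that by (auto simp: add_isolated_def)
      then show ?thesis using h'(1) Inl[of x] by (simp add: permutes_not_in)
    qed
    show "finite (verts G)" using assms(1) by (simp add: simple_graph_def)
  qed
  moreover have "moves_one_edge (edges G) \<gamma>"
  proof -
    from h'(2) obtain e0 where e0: "\<And>e. h' ` e \<in> ?E \<Longrightarrow> e \<in> insert e0 ?E"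
      by (auto simp: moves_one_edge_def)
    \<comment> \<open>If \<open>e0\<close> contains an isolated vertex, it is not the image of any
      set of vertices of \<open>G\<close>, and its preimage serves only as a harmless
      placeholder.\<close>
    have "e \<in> insert (Inl -` e0) (edges G)" if "\<gamma> ` e \<in> edges G" for e
    proof -
      have "h' ` Inl ` e = Inl ` \<gamma> ` e" by (auto simp: image_image Inl)
      then have "h' ` Inl ` e \<in> ?E" using that by (simp add: add_isolated_def)
      then have "Inl ` e \<in> insert e0 ?E" by (rule e0)
      then show ?thesis
        by (auto simp: add_isolated_def inj_image_eq_iff[OF inj_Inl] inj_vimage_image_eq)
    qed
    then show ?thesis unfolding moves_one_edge_def by blast
  qed
  moreover have "\<gamma> u = w" using h'u Inl by simp
  ultimately show ?thesis by blast
qed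

section \<open>The comb product with one isolated vertex\<close>

text \<open>All copies of \<open>H\<close> share the one isolated vertex.\<close>

definition tooth :: "'a \<Rightarrow> 'b + nat \<Rightarrow> ('a \<times> 'b) + nat" where
  "tooth u = map_sum (Pair u) id"

text \<open>Moves whole copies of \<open>H\<close> in the way \<open>\<gamma>\<close> moves their
  roots. Points with second component outside \<open>W\<close> stay fixed, so that the lift of a
  permutation of \<open>verts G\<close> permutes exactly the vertices of the product.\<close>

definition comb_lift :: "'b set \<Rightarrow> ('a \<Rightarrow> 'a) \<Rightarrow> ('a \<times> 'b) + nat \<Rightarrow> ('a \<times> 'b) + nat" where
  "comb_lift W \<gamma> = map_sum (\<lambda>(u, w). (if w \<in> W then \<gamma> u else u, w)) id"

lemma tooth_simps [simp]: "tooth u (Inl w) = Inl (u, w)" "tooth u (Inr n) = Inr n"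
  by (simp_all add: tooth_def)

lemma inj_tooth: "inj (tooth u)"
  by (auto simp: tooth_def inj_def sum.map_comp map_sum_def split: sum.splits)

lemma comb_lift_simps [simp]:
  "w \<in> W \<Longrightarrow> comb_lift W \<gamma> (Inl (u, w)) = Inl (\<gamma> u, w)"
  "w \<notin> W \<Longrightarrow> comb_lift W \<gamma> (Inl (u, w)) = Inl (u, w)"
  "comb_lift W \<gamma> (Inr n) = Inr n"
  by (simp_all add: comb_lift_def)

text \<open>Pulls an edge back through a permutation that fixes its endpoints.\<close>

lemma eq_if_fixed_image:
  assumes "inj f" "f ` e = A" "\<And>x. x \<in> A \<Longrightarrow> f x = x"
  shows "e = A"
proof -
  have "f ` A = A" using assms(3) by force
  then show ?thesis using assms(1,2) by (metis inj_image_eq_iff)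
qed

context
  fixes G :: "'a graph" and H :: "'b graph" and v :: 'b
  assumes G: "simple_graph G" and H: "simple_graph H" and v: "v \<in> verts H"
  notes [simp del] = One_nat_def
begin

private abbreviation (input) "K \<equiv> add_isolated (comb_product G H v) 1"
private abbreviation (input) "HI \<equiv> add_isolated H 1"
private abbreviation (input) "root \<equiv> \<lambda>u. Inl (u, v) :: ('a \<times> 'b) + nat"
private abbreviation (input) "lift \<equiv> comb_lift (verts H)"
private abbreviation (input) "ext_perm u \<equiv> map_permutation (verts HI) (tooth u)"

text \<open>Edges are presented as images under vertex maps, so that later preimage arguments handle
  an edge as a whole instead of its two endpoints.\<close>

private lemma edges_comb_product:
  "edges (comb_product G H v) =
    (`) (\<lambda>u. (u, v)) ` edges G \<union> (\<Union>u\<in>verts G. (`) (Pair u) ` edges H)"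
proof -
  have "{{(u, v), (u', v)} | u u'. {u, u'} \<in> edges G} = (`) (\<lambda>u. (u, v)) ` edges G" (is "?A = ?B")
  proof (intro equalityI subsetI)
    fix e assume "e \<in> ?B"
    then obtain f where f: "f \<in> edges G" "e = (\<lambda>u. (u, v)) ` f" by blast
    from simple_graph_edgeE[OF G f(1)] obtain x y where "f = {x, y}" .
    then show "e \<in> ?A" using f by auto
  next
    fix e assume "e \<in> ?A"
    then obtain u u' where "e = (\<lambda>u. (u, v)) ` {u, u'}" "{u, u'} \<in> edges G" by auto
    then show "e \<in> ?B" by (rule image_eqI)
  qed
  moreover have "{{(u, w), (u, w')} | u w w'. u \<in> verts G \<and> {w, w'} \<in> edges H} =
      (\<Union>u\<in>verts G. (`) (Pair u) ` edges H)" (is "?A = ?B")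
  proof (intro equalityI subsetI)
    fix e assume "e \<in> ?B"
    then obtain u f where f: "u \<in> verts G" "f \<in> edges H" "e = Pair u ` f" by blast
    from simple_graph_edgeE[OF H f(2)] obtain x y where "f = {x, y}" .
    then show "e \<in> ?A" using f by auto
  next
    fix e assume "e \<in> ?A"
    then obtain u w w' where "e = Pair u ` {w, w'}" "u \<in> verts G" "{w, w'} \<in> edges H" by auto
    then show "e \<in> ?B" by (intro UN_I image_eqI)
  qed
  ultimately show ?thesis by (simp add: comb_product_def)
qed

private lemma simple_graph_comb_product: "simple_graph (comb_product G H v)"
proof -
  have "e \<in> all_pairs (verts (comb_product G H v))" if e: "e \<in> edges (comb_product G H v)" for e
    using e unfolding edges_comb_product
  proof
    assume "e \<in> (`) (\<lambda>u. (u, v)) ` edges G"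
    then obtain f where f: "f \<in> edges G" "e = (\<lambda>u. (u, v)) ` f" by blast
    from simple_graph_edgeE[OF G f(1)] obtain x y
      where "f = {x, y}" "x \<in> verts G" "y \<in> verts G" "x \<noteq> y" .
    then show ?thesis
      using f v unfolding all_pairs_def comb_product_def by fastforce
  next
    assume "e \<in> (\<Union>u\<in>verts G. (`) (Pair u) ` edges H)"
    then obtain u f where f: "u \<in> verts G" "f \<in> edges H" "e = Pair u ` f" by blast
    from simple_graph_edgeE[OF H f(2)] obtain x y
      where "f = {x, y}" "x \<in> verts H" "y \<in> verts H" "x \<noteq> y" .
    then show ?thesis
      using f unfolding all_pairs_def comb_product_def by fastforce
  qed
  moreover have "finite (verts (comb_product G H v))"
    using G H by (simp add: simple_graph_def comb_product_def)
  ultimately show ?thesis unfolding simple_graph_def by blast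
qed

private lemma simple_graphs: "simple_graph K" "simple_graph HI"
  by (intro simple_graph_add_isolated simple_graph_comb_product H)+

private lemma edges_comb:
  "edges K = (`) root ` edges G \<union> (\<Union>u\<in>verts G. (`) (tooth u) ` edges HI)"
proof -
  have "(`) (tooth u) ` edges HI = (`) Inl ` (`) (Pair u) ` edges H" for u :: 'a
    by (simp add: add_isolated_def image_image)
  moreover have "edges K = (`) Inl ` edges (comb_product G H v)"
    by (simp add: add_isolated_def)
  ultimately show ?thesis
    unfolding edges_comb_product by (simp add: image_Un image_UN image_image)
qed

private lemma edges_combE:
  assumes "e \<in> edges K"
  obtains f where "f \<in> edges G" "e = root ` f"
    | u f where "u \<in> verts G" "f \<in> edges HI" "e = tooth u ` f"
  using assms unfolding edges_comb by (elim UnE UN_E imageE)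

private lemma root_edge: "f \<in> edges G \<Longrightarrow> root ` f \<in> edges K"
  unfolding edges_comb by (rule UnI1) (rule imageI)

private lemma tooth_edge: "u \<in> verts G \<Longrightarrow> f \<in> edges HI \<Longrightarrow> tooth u ` f \<in> edges K"
  unfolding edges_comb by (rule UnI2) (rule UN_I, assumption, rule imageI)

private lemma verts_comb: "verts K = Inl ` (verts G \<times> verts H) \<union> {Inr 0}"
  by (auto simp: add_isolated_def comb_product_def)

private lemma verts_HI: "verts HI = Inl ` verts H \<union> {Inr 0}"
  by (auto simp: add_isolated_def)

private lemma tooth_in_comb: "u \<in> verts G \<Longrightarrow> tooth u ` verts HI \<subseteq> verts K"
  by (auto simp: verts_comb verts_HI)

section \<open>Permutations of one copy of \<open>H\<close>, extended by the identity\<close>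

private lemma extend_permutes:
  assumes "u \<in> verts G" "\<sigma> permutes verts HI"
  shows "ext_perm u \<sigma> permutes verts K"
  using map_permutation_permutes[OF inj_on_imp_bij_betw[OF inj_on_subset[OF inj_tooth]] assms(2)]
    tooth_in_comb[OF assms(1)]
  by (rule permutes_subset) simp

private lemma extend_tooth:
  assumes "\<sigma> permutes verts HI" "x \<in> verts HI"
  shows "ext_perm u \<sigma> (tooth u x) = tooth u (\<sigma> x)"
  using assms by (intro map_permutation_apply inj_on_subset[OF inj_tooth]) auto

private lemma extend_other: "u' \<noteq> u \<Longrightarrow> ext_perm u \<sigma> (Inl (u', w)) = Inl (u', w)"
  unfolding map_permutation_def by (rule restrict_id_simps) (auto simp: verts_HI)

text \<open>Away from the copy at \<open>u\<close> the extension is the identity, so edges of other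
  copies and root edges avoiding \<open>u\<close> pull back to themselves. Edges of the copy at
  \<open>u\<close> pull back through \<open>\<sigma>\<close>. Root edges at \<open>u\<close> are
  left to the callers.\<close>

private lemma extend_image_edge:
  assumes u: "u \<in> verts G" and \<sigma>: "\<sigma> permutes verts HI" and e: "ext_perm u \<sigma> ` e \<in> edges K"
  shows "e \<in> edges K \<or> (\<exists>f. e = tooth u ` f \<and> \<sigma> ` f \<in> edges HI) \<or>
    (\<exists>f\<in>edges G. u \<in> f \<and> ext_perm u \<sigma> ` e = root ` f)"
proof -
  note inj = permutes_inj[OF extend_permutes[OF u \<sigma>]]
  note fixed = eq_if_fixed_image[OF inj]
  from e show ?thesis
  proof (cases rule: edges_combE)
    case (1 f)
    then show ?thesis
    proof (cases "u \<in> f")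
      case False
      then have "e = root ` f"
        by (intro fixed[OF 1(2)]) (auto intro!: extend_other)
      then show ?thesis using 1 by (simp add: root_edge)
    qed blast
  next
    case (2 u' f)
    show ?thesis
    proof (cases "u' = u")
      case True
      let ?f = "inv_into UNIV \<sigma> ` f"
      have f: "\<sigma> ` ?f = f"
        by (simp add: image_f_inv_f permutes_surj[OF \<sigma>])
      \<comment> \<open>The extension follows \<open>\<sigma>\<close> on \<open>verts HI\<close>
        only, so the pulled-back edge has to stay inside.\<close>
      have "?f \<subseteq> verts HI"
        using image_mono[OF simple_graph_edge_subset[OF simple_graphs(2) 2(2)],
            of "inv_into UNIV \<sigma>"] permutes_image[OF permutes_inv[OF \<sigma>]]
        by simp
      then have "(\<lambda>x. ext_perm u \<sigma> (tooth u x)) ` ?f = (\<lambda>x. tooth u (\<sigma> x)) ` ?f"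
        by (intro image_cong refl extend_tooth[OF \<sigma>]) (rule subsetD)
      then have "ext_perm u \<sigma> ` tooth u ` ?f = tooth u ` \<sigma> ` ?f"
        by (simp only: image_image)
      then have "e = tooth u ` ?f"
        using 2(3) True inj unfolding f by (metis inj_image_eq_iff)
      moreover have "\<sigma> ` ?f \<in> edges HI" using f 2(2) by simp
      ultimately show ?thesis by blast
    next
      case False
      \<comment> \<open>An edge avoids the isolated vertex, the one point shared by the copies at
        \<open>u\<close> and \<open>u'\<close>, so the extension fixes the edge pointwise.\<close>
      have "f \<subseteq> Inl ` verts H"
        using 2(2) simple_graph_edge_subset[OF H] by (auto simp: add_isolated_def)
      then have "e = tooth u' ` f"
        using False by (intro fixed[OF 2(3)]) (auto intro!: extend_other)
      then show ?thesis using 2 by (simp add: tooth_edge)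
    qed
  qed
qed

text \<open>The extension fixes all roots and hence every root edge; the only possible new edge is
  the one that \<open>\<sigma>\<close> produces inside the copy at \<open>u\<close>.\<close>

private lemma extend_root_fixing_in_Fer_generators:
  assumes u: "u \<in> verts G" and \<sigma>: "\<sigma> \<in> Fer_generators id HI" "\<sigma> (Inl v) = Inl v"
  shows "ext_perm u \<sigma> \<in> Fer_generators id K"
proof -
  from \<sigma>(1) have perm: "\<sigma> permutes verts HI" and "moves_one_edge (edges HI) \<sigma>"
    by (simp_all add: Fer_generators_iff[OF simple_graphs(2)])
  then obtain e0 where e0: "\<And>e. \<sigma> ` e \<in> edges HI \<Longrightarrow> e \<in> insert e0 (edges HI)"
    by (auto simp: moves_one_edge_def)
  have root: "ext_perm u \<sigma> (root u') = root u'" for u'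
  proof (cases "u' = u")
    case True
    then show ?thesis
      using extend_tooth[OF perm, of "Inl v" u] v \<sigma>(2) by (simp add: verts_HI)
  qed (rule extend_other)
  have "e \<in> insert (tooth u ` e0) (edges K)" if e: "ext_perm u \<sigma> ` e \<in> edges K" for e
  proof -
    consider "e \<in> edges K" | f where "e = tooth u ` f" "\<sigma> ` f \<in> edges HI"
      | f where "f \<in> edges G" "ext_perm u \<sigma> ` e = root ` f"
      using extend_image_edge[OF u perm e] by blast
    then show ?thesis
    proof cases
      case 2
      then show ?thesis using e0[of f] u by (auto intro: tooth_edge)
    next
      case 3
      have "e = root ` f"
        by (rule eq_if_fixed_image[OF permutes_inj[OF extend_permutes[OF u perm]] 3(2)])
          (auto simp: root)
      then show ?thesis using 3 by (simp add: root_edge)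
    qed simp
  qed
  then show ?thesis
    using extend_permutes[OF u perm]
    unfolding Fer_generators_iff[OF simple_graphs(1)] moves_one_edge_def by blast
qed

text \<open>No new edge arises inside the copy at \<open>u\<close>. If \<open>\<sigma>\<close> moves
  the root, only root edges at \<open>u\<close> are displaced, and \<open>e0\<close> is the only
  candidate for such an edge.\<close>

private lemma extend_automorphism_in_Fer_generators:
  assumes u: "u \<in> verts G" and leaf: "\<And>e. e \<in> edges G \<Longrightarrow> u \<in> e \<Longrightarrow> e = e0"
    and \<sigma>: "\<sigma> \<in> Aut id HI"
  shows "ext_perm u \<sigma> \<in> Fer_generators id K"
proof -
  note \<sigma> = iffD1[OF Aut_iff[OF simple_graphs(2)] \<sigma>]
  note perm = conjunct1[OF \<sigma>] and aut = conjunct2[OF \<sigma>, rule_format]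
  let ?e = "inv_into UNIV (ext_perm u \<sigma>) ` root ` e0"
  have "e \<in> insert ?e (edges K)" if e: "ext_perm u \<sigma> ` e \<in> edges K" for e
  proof -
    consider "e \<in> edges K" | f where "e = tooth u ` f" "\<sigma> ` f \<in> edges HI"
      | f where "f \<in> edges G" "u \<in> f" "ext_perm u \<sigma> ` e = root ` f"
      using extend_image_edge[OF u perm e] by blast
    then show ?thesis
    proof cases
      case 2
      then show ?thesis using aut u by (simp add: tooth_edge)
    next
      case 3
      then have "ext_perm u \<sigma> ` e = root ` e0" using leaf[of f] by simp
      then have "?e = e"
        using permutes_inj[OF extend_permutes[OF u perm]] by (metis image_inv_f_f)
      then show ?thesis by simp
    qed simp
  qed
  then show ?thesis
    using extend_permutes[OF u perm]
    unfolding Fer_generators_iff[OF simple_graphs(1)] moves_one_edge_def by blast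
qed

section \<open>Permutations of \<open>G\<close>, lifted to all copies of \<open>H\<close>\<close>

private lemma lift_permutes:
  assumes "\<gamma> permutes verts G"
  shows "lift \<gamma> permutes verts K"
proof (rule inj_imp_permutes)
  show "inj_on (lift \<gamma>) (verts K)"
    using permutes_inj[OF assms] by (auto simp: inj_on_def verts_comb)
  show "lift \<gamma> x \<in> verts K" if "x \<in> verts K" for x
    using that assms by (auto simp: verts_comb permutes_in_image)
  show "lift \<gamma> x = x" if x: "x \<notin> verts K" for x
  proof (cases x)
    case (Inl p)
    obtain u w where "p = (u, w)" by (cases p)
    then have "w \<in> verts H \<Longrightarrow> u \<notin> verts G" using x Inl by (auto simp: verts_comb)
    then show ?thesis
      using Inl \<open>p = (u, w)\<close> assms by (cases "w \<in> verts H") (simp_all add: permutes_not_in)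
  qed simp
  show "finite (verts K)" using simple_graphs(1) by (simp add: simple_graph_def)
qed

private lemma lift_tooth:
  assumes "x \<in> verts HI"
  shows "lift \<gamma> (tooth u x) = tooth (\<gamma> u) x"
  using assms by (auto simp: verts_HI)

text \<open>The lift carries copies of \<open>H\<close> rigidly onto copies of \<open>H\<close> and
  acts on root edges as \<open>\<gamma>\<close> acts on edges of \<open>G\<close>, so the only
  possible new edge is the root image of the one for \<open>\<gamma>\<close>.\<close>

private lemma lift_in_Fer:
  assumes \<gamma>: "\<gamma> permutes verts G" "moves_one_edge (edges G) \<gamma>"
  shows "lift \<gamma> \<in> Fer id K"
proof (rule permutation_in_Fer[OF simple_graphs(1) lift_permutes[OF \<gamma>(1)]])
  let ?\<delta> = "inv_into UNIV \<gamma>"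
  have inv: "\<gamma> (?\<delta> x) = x" for x by (rule permutes_inverses(1)[OF \<gamma>(1)])
  note inj = permutes_inj[OF lift_permutes[OF \<gamma>(1)]]
  from \<gamma>(2) obtain e0 where e0: "\<And>e. \<gamma> ` e \<in> edges G \<Longrightarrow> e \<in> insert e0 (edges G)"
    by (auto simp: moves_one_edge_def)
  have "e \<in> insert (root ` e0) (edges K)" if e: "lift \<gamma> ` e \<in> edges K" for e
  proof -
    from e show ?thesis
    proof (cases rule: edges_combE)
      case (1 f)
      have "lift \<gamma> ` root ` ?\<delta> ` f = root ` f" using v by (simp add: image_image inv)
      then have "e = root ` ?\<delta> ` f" using 1(2) inj by (metis inj_image_eq_iff)
      moreover have "?\<delta> ` f \<in> insert e0 (edges G)"
        using 1(1) by (intro e0) (simp add: image_image inv)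
      ultimately show ?thesis using root_edge by blast
    next
      case (2 u f)
      have "lift \<gamma> ` tooth (?\<delta> u) ` f = (\<lambda>x. tooth (\<gamma> (?\<delta> u)) x) ` f"
        unfolding image_image
        using simple_graph_edge_subset[OF simple_graphs(2) 2(2)]
        by (intro image_cong refl lift_tooth) blast
      then have "e = tooth (?\<delta> u) ` f"
        using 2(3) inj by (metis inj_image_eq_iff inv)
      moreover have "?\<delta> u \<in> verts G"
        using 2(1) permutes_inv[OF \<gamma>(1)] by (simp add: permutes_in_image)
      ultimately show ?thesis using 2(2) by (simp add: tooth_edge)
    qed
  qed
  then show "moves_one_edge (edges K) (lift \<gamma>)" unfolding moves_one_edge_def by blast
qed

section \<open>Vertices of \<open>G\<close> whose whole copy of \<open>H\<close> can be exchanged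
  with the isolated vertex\<close>

private definition star_vertex :: "'a \<Rightarrow> bool" where
  "star_vertex u \<longleftrightarrow> (\<forall>w\<in>verts H. transpose (Inl (u, w)) (Inr 0) \<in> Fer id K)"

private lemma Fer_carrier: "Fer_generators id K \<subseteq> carrier (Sym (verts K))"
  by (rule Fer_generators_carrier[OF simple_graphs(1)])

text \<open>Hang-symmetry writes the transposition in \<open>HI\<close> as a product of root-fixing
  generators, automorphisms and their inverses. Both kinds of generators extend to generators of the
  product, the automorphisms thanks to the degree bound at \<open>u\<close>.\<close>

private lemma star_vertex_leaf:
  assumes hang: "hang_symmetric HI (Inl v)"
    and u: "u \<in> verts G" and leaf: "\<And>e. e \<in> edges G \<Longrightarrow> u \<in> e \<Longrightarrow> e = e0"
  shows "star_vertex u"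
  unfolding star_vertex_def
proof
  fix w assume w: "w \<in> verts H"
  let ?\<tau> = "transpose (Inl w) (Inr 0) :: 'b + nat \<Rightarrow> 'b + nat"
  let ?S = "{\<sigma> \<in> Fer_generators id HI. \<sigma> (Inl v) = Inl v} \<union> Aut id HI"
  have mem: "Inl w \<in> verts HI" "Inr 0 \<in> verts HI" using w by (auto simp: verts_HI)
  then have "?\<tau> \<in> carrier (Sym (verts HI))"
    by (simp add: Sym_def permutes_swap_id)
  then have "?\<tau> \<in> generate (Sym (verts HI)) ?S"
    using hang by (simp add: hang_symmetric_def hang_group_def labels_id)
  moreover have "?S \<subseteq> carrier (Sym (verts HI))"
    using Fer_generators_carrier[OF simple_graphs(2)]
    by (auto simp: Aut_iff[OF simple_graphs(2)] Sym_def)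
  moreover have "ext_perm u \<sigma> \<in> Fer_generators id K" if "\<sigma> \<in> ?S" for \<sigma>
    using that extend_root_fixing_in_Fer_generators[OF u]
      extend_automorphism_in_Fer_generators[OF u leaf] by blast
  ultimately have "ext_perm u ?\<tau> \<in> generate (Sym (verts K)) (Fer_generators id K)"
    by (intro map_permutation_in_generate[where K = ?S] inj_on_subset[OF inj_tooth]
        tooth_in_comb[OF u] Fer_carrier) auto
  moreover have "ext_perm u ?\<tau> = transpose (tooth u (Inl w)) (tooth u (Inr 0))"
    by (intro map_permutation_transpose inj_on_subset[OF inj_tooth] mem) simp
  ultimately show "transpose (Inl (u, w)) (Inr 0) \<in> Fer id K"
    by (simp add: Fer_def labels_id)
qed

text \<open>Conjugation by the lift of \<open>\<gamma>\<close> fixes the isolated vertex and carries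
  the copy at \<open>u\<close> to the copy at \<open>\<gamma> u\<close>.\<close>

private lemma star_vertex_transport:
  assumes "star_vertex u" "\<gamma> permutes verts G" "moves_one_edge (edges G) \<gamma>"
  shows "star_vertex (\<gamma> u)"
  unfolding star_vertex_def
proof
  fix w assume w: "w \<in> verts H"
  let ?\<tau> = "transpose (Inl (u, w)) (Inr 0) :: ('a \<times> 'b) + nat \<Rightarrow> _"
  let ?\<delta> = "inv_into UNIV (lift \<gamma>)"
  note perm = lift_permutes[OF assms(2)]
  have "?\<tau> \<in> Fer id K" using assms(1) w by (simp add: star_vertex_def)
  moreover have "?\<delta> \<in> Fer id K"
    using generate_inv[OF Fer_carrier] lift_in_Fer[OF assms(2,3)] by (simp add: Fer_def labels_id)
  ultimately have "lift \<gamma> \<circ> ?\<tau> \<circ> ?\<delta> \<in> Fer id K"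
    using lift_in_Fer[OF assms(2,3)] unfolding Fer_def labels_id by (intro generate_comp)
  moreover have "lift \<gamma> \<circ> ?\<tau> \<circ> ?\<delta> = transpose (Inl (\<gamma> u, w)) (Inr 0)"
  proof -
    have "transpose (Inl (\<gamma> u, w)) (Inr 0) \<circ> lift \<gamma> = lift \<gamma> \<circ> ?\<tau>"
    proof -
      have "?\<delta> (Inl (\<gamma> u, w)) = Inl (u, w)" "?\<delta> (Inr 0) = Inr 0"
        using w permutes_inv_eq[OF perm] by simp_all
      then show ?thesis
        using transpose_comp_eq[OF permutes_bij[OF perm]] by metis
    qed
    then show ?thesis
      by (metis comp_assoc comp_id permutes_inv_o(1)[OF perm])
  qed
  ultimately show "transpose (Inl (\<gamma> u, w)) (Inr 0) \<in> Fer id K" by simp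
qed

text \<open>By finiteness it suffices that \<open>h\<close> maps \<open>S\<close> into itself. A
  star vertex sent into \<open>G\<close> transports along the restricted generator; an isolated
  vertex sent into \<open>G\<close> lands on a vertex of degree at most one. Isolated vertices
  belong to \<open>S\<close> because they are where the orbit argument starts.\<close>

private lemma star_vertex_step:
  assumes hang: "hang_symmetric HI (Inl v)"
    and h: "h \<in> Fer_generators id (add_isolated G t)"
  defines "S \<equiv> Inl ` {u \<in> verts G. star_vertex u} \<union> Inr ` {..<t}"
  shows "h ` S = S"
proof (rule endo_inj_surj)
  let ?GT = "add_isolated G t"
  note GT = simple_graph_add_isolated[OF G, of t]
  from h have perm: "h permutes verts ?GT" and move: "moves_one_edge (edges ?GT) h"
    by (simp_all add: Fer_generators_iff[OF GT])
  show "finite S" using G by (simp add: S_def simple_graph_def)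
  show "inj_on h S" using permutes_inj[OF perm] by (rule inj_on_subset) simp
  show "h ` S \<subseteq> S"
  proof
    fix y assume "y \<in> h ` S"
    then obtain x where x: "x \<in> S" "y = h x" by blast
    have xV: "x \<in> verts ?GT" using x by (auto simp: S_def add_isolated_def)
    then have yV: "y \<in> verts ?GT" using x perm by (simp add: permutes_in_image)
    show "y \<in> S"
    proof (cases y)
      case (Inr n)
      then show ?thesis using yV by (auto simp: S_def add_isolated_def)
    next
      case (Inl w)
      then have w: "w \<in> verts G" using yV by (auto simp: add_isolated_def)
      have "star_vertex w"
      proof (cases x)
        case (Inl u)
        then have u: "star_vertex u" using x by (auto simp: S_def)
        have "h (Inl u) = Inl w" using x Inl \<open>y = Inl w\<close> by simp
        from moves_one_edge_restrict_add_isolated[OF G perm move this]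
        obtain \<gamma> where "\<gamma> permutes verts G" "moves_one_edge (edges G) \<gamma>" "\<gamma> u = w" by blast
        then show ?thesis using star_vertex_transport[OF u] by blast
      next
        case (Inr n)
        from move obtain e0 where e0: "\<And>e. h ` e \<in> edges ?GT \<Longrightarrow> e \<in> insert e0 (edges ?GT)"
          by (auto simp: moves_one_edge_def)
        show ?thesis
        proof (rule star_vertex_leaf[OF hang w])
          \<comment> \<open>The preimage under \<open>h\<close> of an edge at \<open>w\<close>
            contains the isolated vertex \<open>Inr n\<close>, so it is not an edge and must be the
            single exception \<open>e0\<close>. This determines the edge at
            \<open>w\<close>.\<close>
          fix f assume f: "f \<in> edges G" "w \<in> f"
          let ?e = "inv_into UNIV h ` Inl ` f"
          have he: "h ` ?e = Inl ` f" by (simp add: image_f_inv_f permutes_surj[OF perm])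
          have "inv_into UNIV h (Inl w) = Inr n"
            using x Inr Inl permutes_inv_eq[OF perm] by simp
          then have "Inr n \<in> ?e" using f(2) by (metis imageI)
          then have "?e \<notin> edges ?GT" by (auto simp: add_isolated_def)
          moreover have "h ` ?e \<in> edges ?GT" unfolding he using f(1) by (simp add: add_isolated_def)
          ultimately have "?e = e0" using e0 by blast
          then have "Inl ` f = h ` e0" using he by simp
          then show "f = Inl -` h ` e0" by (metis inj_Inl inj_vimage_image_eq)
        qed
      qed
      then show ?thesis using Inl w by (auto simp: S_def)
    qed
  qed
qed

text \<open>The full symmetric group on the vertices of \<open>G\<close> with \<open>t\<close>
  isolated vertices preserves the set of star and isolated vertices. By transitivity every vertex of
  \<open>G\<close> is a star vertex, and the resulting transpositions generate.\<close>

lemma local_amoeba_comb_product: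
  assumes "global_amoeba G" and hang: "hang_symmetric (add_isolated H 1) (Inl v)"
  shows "local_amoeba (add_isolated (comb_product G H v) 1)"
proof -
  from assms(1) obtain t where t: "t \<ge> 1" and amoeba: "local_amoeba (add_isolated G t)"
    by (auto simp: global_amoeba_def)
  let ?GT = "add_isolated G t"
  let ?S = "Inl ` {u \<in> verts G. star_vertex u} \<union> Inr ` {..<t}"
  have generator: "h permutes verts ?GT \<and> h ` ?S = ?S" if "h \<in> Fer_generators id ?GT" for h
    using star_vertex_step[OF hang that] that
    by (simp add: Fer_generators_iff[OF simple_graph_add_isolated[OF G]])
  have orbit: "p permutes verts ?GT \<and> p ` ?S = ?S" if "p \<in> Fer id ?GT" for p
    using generate_stabilizes[OF generator that[unfolded Fer_def labels_id]] .
  have star: "star_vertex u" if u: "u \<in> verts G" for u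
  proof -
    let ?\<tau> = "transpose (Inr 0) (Inl u) :: 'a + nat \<Rightarrow> _"
    have "?\<tau> permutes verts ?GT"
      using u t by (intro permutes_swap_id) (auto simp: add_isolated_def)
    then have "?\<tau> \<in> Fer id ?GT"
      using amoeba by (simp add: local_amoeba_def labels_id Sym_def)
    note stable = conjunct2[OF orbit[OF this]]
    \<comment> \<open>Here \<open>t \<ge> 1\<close> supplies the isolated vertex from which
      \<open>u\<close> is reached.\<close>
    have "Inr 0 \<in> ?S" using t by auto
    from imageI[OF this, of ?\<tau>] have "?\<tau> (Inr 0) \<in> ?S" unfolding stable .
    then show ?thesis by auto
  qed
  have "generate (Sym (verts K)) (Fer_generators id K) = carrier (Sym (verts K))"
  proof (rule generate_eq_Sym_if_star_transpositions[OF _ Fer_carrier])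
    show "finite (verts K)" using simple_graphs(1) by (simp add: simple_graph_def)
    fix x assume "x \<in> verts K"
    then consider u w where "x = Inl (u, w)" "u \<in> verts G" "w \<in> verts H" | "x = Inr 0"
      by (auto simp: verts_comb)
    then show "transpose x (Inr 0) \<in> generate (Sym (verts K)) (Fer_generators id K)"
    proof cases
      case 1
      then show ?thesis
        using star[OF 1(2)] by (simp add: star_vertex_def Fer_def labels_id)
    next
      case 2
      have "id = \<one>\<^bsub>Sym (verts K)\<^esub>" by (simp add: Sym_def)
      then show ?thesis using 2 by (metis generate.one transpose_same)
    qed
  qed
  then show ?thesis by (simp add: local_amoeba_def Fer_def labels_id)
qed

end

theorem theorem4:
  fixes G :: "'a graph" and H :: "'b graph" and v :: 'b
  assumes "simple_graph G" and "simple_graph H" and "v \<in> verts H"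
    and "global_amoeba G"
    and "hang_symmetric (add_isolated H 1) (Inl v)"
  shows "global_amoeba (comb_product G H v)"
  \<comment> \<open>The number of isolated vertices for the product is \<open>1\<close>, whatever
    number was used for \<open>G\<close>.\<close>
  using local_amoeba_comb_product[OF assms] by (auto simp: global_amoeba_def)

end
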